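(* Let $H>0$, $\alpha>0$, $\beta>0$, and let $g:[0,H]\to(0,\infty)$ be continuously differentiable. Let $B$ be the solid of revolution generated by $g$, with surface area density $\alpha$, and let $T_{sr}(h)$ be the distance between $P_0$ and the Center of Gravity of $B$ filled with material of volume density $\beta$ up to the plane $P_h$, $0\le h\le H$ (all as defined in the context). Then $T_{sr}$ is given by $$T_{sr}(h)=\frac{\alpha S_1+\pi\beta\int_0^h z\,g(z)^2\,dz}{\alpha S_0+\pi\beta\int_0^h g(z)^2\,dz},\qquad 0\le h\le H,$$ the (unique) minimum point of $T_{sr}$ on $[0,H]$ coincides with the (unique) fixed point of $T_{sr}$ in $[0,H]$ (the point $h$ with $T_{sr}(h)=h$), and $T_{sr}$ satisfies the differential equation $$T_{sr}'(h)=-\frac{m_0'(h)}{m_0(h)}\,\bigl(T_{sr}(h)-h\bigr),\qquad 0\le h\le H,\qquad\text{where } m_0(h)=\alpha S_0+\pi\beta\int_0^h g(z)^2\,dz .$$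
   Context: Let $D=\{(x,0,z): 0\le x\le g(z),\ 0\le z\le H\}\subset\mathbb{R}^3$. The solid $B$ with surface $S$ is generated when the set $D$ and the curve $x=g(z)$, $0\le z\le H$, respectively, are rotated around the vertical $z$-axis (so $S$ is the lateral surface). $P_h$ denotes the horizontal plane $z=h$. The surface $S$ has constant area density $\alpha$, and the filling material, occupying the part of $B$ between $P_0$ and $P_h$, has constant volume density $\beta$. The zeroth and first moments of $S$ relative to $P_0$ (without the density factor) are $$S_0=2\pi\int_0^H g(z)\sqrt{1+g'(z)^2}\,dz,\qquad S_1=2\pi\int_0^H z\,g(z)\sqrt{1+g'(z)^2}\,dz .$$ The height $T_{sr}(h)$ of the Center of Gravity above $P_0$ is the quotient $m_1(h)/m_0(h)$ of the first moment (relative to $P_0$) and the zeroth moment (total mass) of the surface $S$ together with the material; the horizontal cross-section of $B$ at height $z$ is a disc of radius $g(z)$. Derivatives at the endpoints $h=0$ and $h=H$ are one-sided. *)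

theory Defs
  imports "HOL-Analysis.Analysis"
begin

text \<open>Points of three-dimensional space are triples \<open>(x, y, z)\<close>, and volume is the Lebesgue measure
  on \<^typ>\<open>real \<times> real \<times> real\<close>.\<close>

definition profile :: "(real \<Rightarrow> real) \<Rightarrow> real \<Rightarrow> (real \<times> real \<times> real) set" where
  "profile g H = {(x, 0, z) | x z. 0 \<le> x \<and> x \<le> g z \<and> 0 \<le> z \<and> z \<le> H}"

definition rotate_z :: "real \<Rightarrow> real \<times> real \<times> real \<Rightarrow> real \<times> real \<times> real" where
  "rotate_z t = (\<lambda>(x, y, z). (x * cos t - y * sin t, x * sin t + y * cos t, z))"

definition solid :: "(real \<Rightarrow> real) \<Rightarrow> real \<Rightarrow> (real \<times> real \<times> real) set" where
  "solid g H = (\<Union>t. rotate_z t ` profile g H)"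

definition filled_part :: "(real \<Rightarrow> real) \<Rightarrow> real \<Rightarrow> real \<Rightarrow> (real \<times> real \<times> real) set" where
  "filled_part g H h = {(x, y, z). (x, y, z) \<in> solid g H \<and> 0 \<le> z \<and> z \<le> h}"

text \<open>Moments of the lateral surface relative to the plane \<open>z = 0\<close>, without the density factor. The
  argument \<open>g'\<close> stands for the derivative of \<open>g\<close> relative to \<open>{0..H}\<close>, one-sided at the endpoints;
  \<open>2 * pi * g z * sqrt (1 + (g' z)\<^sup>2) dz\<close> is the area element of a surface of revolution.\<close>

definition surface_moment0 :: "(real \<Rightarrow> real) \<Rightarrow> (real \<Rightarrow> real) \<Rightarrow> real \<Rightarrow> real" where
  "surface_moment0 g g' H = 2 * pi * integral {0..H} (\<lambda>z. g z * sqrt (1 + (g' z)\<^sup>2))"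

definition surface_moment1 :: "(real \<Rightarrow> real) \<Rightarrow> (real \<Rightarrow> real) \<Rightarrow> real \<Rightarrow> real" where
  "surface_moment1 g g' H = 2 * pi * integral {0..H} (\<lambda>z. z * g z * sqrt (1 + (g' z)\<^sup>2))"

text \<open>Moments of the surface (area density \<open>\<alpha>\<close>) together with the filling material (volume density
  \<open>\<beta>\<close>) up to height \<open>h\<close>, as integrals over the three-dimensional filled region.\<close>

definition moment0 ::
  "real \<Rightarrow> real \<Rightarrow> (real \<Rightarrow> real) \<Rightarrow> (real \<Rightarrow> real) \<Rightarrow> real \<Rightarrow> real \<Rightarrow> real" where
  "moment0 \<alpha> \<beta> g g' H h =
     \<alpha> * surface_moment0 g g' H + \<beta> * measure lborel (filled_part g H h)"

definition moment1 ::
  "real \<Rightarrow> real \<Rightarrow> (real \<Rightarrow> real) \<Rightarrow> (real \<Rightarrow> real) \<Rightarrow> real \<Rightarrow> real \<Rightarrow> real" where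
  "moment1 \<alpha> \<beta> g g' H h =
     \<alpha> * surface_moment1 g g' H
     + \<beta> * set_lebesgue_integral lborel (filled_part g H h) (\<lambda>(x, y, z). z)"

definition T_sr ::
  "real \<Rightarrow> real \<Rightarrow> (real \<Rightarrow> real) \<Rightarrow> (real \<Rightarrow> real) \<Rightarrow> real \<Rightarrow> real \<Rightarrow> real" where
  "T_sr \<alpha> \<beta> g g' H h = moment1 \<alpha> \<beta> g g' H h / moment0 \<alpha> \<beta> g g' H h"

end

theory Submission
  imports Defs
begin

text \<open>Slicing the filled part into horizontal discs gives the moments \<open>m0\<close>, \<open>m1\<close> as one-dimensional
  integrals, so that \<open>m1' h = h * m0' h\<close>, and the differential equation is the quotient rule. Hence
  \<open>D h = h * m0 h - m1 h\<close>, whose zeros are the fixed points, satisfies \<open>D' = m0 > 0\<close>; it is negative at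
  \<open>0\<close> and positive at \<open>H\<close>, so it has exactly one zero \<open>h0\<close>. For \<open>h \<noteq> h0\<close> the mean value theorem gives
  \<open>D h = (h - h0) * m0 x\<close> for some \<open>x\<close> between \<open>h0\<close> and \<open>h\<close>, and therefore
  \<open>m1 h - h0 * m0 h = (h - h0) * (m0 h - m0 x) > 0\<close> because \<open>m0\<close> is increasing; that is,
  \<open>m1 h / m0 h > h0\<close>.\<close>

section \<open>Coordinate description of the solid and of its filled part\<close>

text \<open>Rotations preserve \<open>x\<^sup>2 + y\<^sup>2\<close>, and every point of the plane is
  a rotated point of the nonnegative half-axis. The sign condition on \<open>g\<close> matters:
  where \<open>g z < 0\<close> the profile has no point, although the squared inequality would still
  describe a disc.\<close>

lemma mem_solid_iff:
  assumes "\<And>z. z \<in> {0..H} \<Longrightarrow> 0 \<le> g z"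
  shows "(x, y, z) \<in> solid g H \<longleftrightarrow> z \<in> {0..H} \<and> x\<^sup>2 + y\<^sup>2 \<le> (g z)\<^sup>2"
proof
  assume "(x, y, z) \<in> solid g H"
  then obtain t r where r: "0 \<le> r" "r \<le> g z" "z \<in> {0..H}"
    and xy: "x = r * cos t" "y = r * sin t"
    unfolding solid_def profile_def rotate_z_def by fastforce
  have "x\<^sup>2 + y\<^sup>2 = r\<^sup>2 * ((cos t)\<^sup>2 + (sin t)\<^sup>2)"
    unfolding xy by algebra
  also have "\<dots> \<le> (g z)\<^sup>2"
    using r by (simp add: power_mono)
  finally show "z \<in> {0..H} \<and> x\<^sup>2 + y\<^sup>2 \<le> (g z)\<^sup>2"
    using r by simp
next
  assume *: "z \<in> {0..H} \<and> x\<^sup>2 + y\<^sup>2 \<le> (g z)\<^sup>2"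
  \<comment> \<open>Polar coordinates come from the complex plane: \<open>cmod w\<close> is the
    radius of the profile point and \<open>Arg w\<close> the angle of rotation.\<close>
  define w where "w = Complex x y"
  have "cmod w \<le> g z"
    using * assms[of z] by (simp add: w_def cmod_def real_le_lsqrt)
  then have "(cmod w, 0, z) \<in> profile g H"
    using * by (simp add: profile_def)
  moreover have "x = cmod w * cos (Arg w)" "y = cmod w * sin (Arg w)"
    using rcis_cmod_Arg[of w] by (simp_all add: complex_eq_iff w_def)
  then have "(x, y, z) = rotate_z (Arg w) (cmod w, 0, z)"
    by (simp add: rotate_z_def)
  ultimately show "(x, y, z) \<in> solid g H"
    unfolding solid_def by blast
qed

lemma mem_filled_part_iff:
  assumes "\<And>z. z \<in> {0..H} \<Longrightarrow> 0 \<le> g z" and "h \<le> H"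
  shows "(x, y, z) \<in> filled_part g H h \<longleftrightarrow> z \<in> {0..h} \<and> x\<^sup>2 + y\<^sup>2 \<le> (g z)\<^sup>2"
proof -
  have "(x, y, z) \<in> filled_part g H h \<longleftrightarrow>
      (z \<in> {0..H} \<and> x\<^sup>2 + y\<^sup>2 \<le> (g z)\<^sup>2) \<and> 0 \<le> z \<and> z \<le> h"
    using mem_solid_iff[of H g x y z] assms(1) by (simp add: filled_part_def)
  then show ?thesis
    using assms(2) by auto
qed

text \<open>Closedness supplies the Borel measurability that the integrals below require.\<close>

lemma closed_filled_part:
  assumes "\<And>z. z \<in> {0..H} \<Longrightarrow> 0 \<le> g z" and "continuous_on {0..H} g" and "h \<le> H"
  shows "closed (filled_part g H h)"
proof -
  \<comment> \<open>Since \<open>g\<close> is continuous only on \<open>{0..H}\<close>, the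
    inequality is a closed condition relative to this slab, which is itself closed.\<close>
  let ?S = "UNIV \<times> UNIV \<times> {0..h} :: (real \<times> real \<times> real) set"
  have "continuous_on ?S (\<lambda>p. g (snd (snd p)))"
    by (rule continuous_on_compose2[OF assms(2)]) (use assms(3) in \<open>auto intro!: continuous_intros\<close>)
  then have "closed {p \<in> ?S. (fst p)\<^sup>2 + (fst (snd p))\<^sup>2 \<le> (g (snd (snd p)))\<^sup>2}"
    by (intro continuous_on_closed_Collect_le closed_Times continuous_intros) auto
  also have "{p \<in> ?S. (fst p)\<^sup>2 + (fst (snd p))\<^sup>2 \<le> (g (snd (snd p)))\<^sup>2} = filled_part g H h"
    using mem_filled_part_iff[OF assms(1,3)] by auto
  finally show ?thesis .
qed

section \<open>Slicing into horizontal discs\<close>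

text \<open>The norm on a product type is Euclidean, so the known volume of balls gives the area of
  a disc.\<close>

lemma disc_eq_cball: "{(x, y). x\<^sup>2 + y\<^sup>2 \<le> r\<^sup>2} = cball (0 :: real \<times> real) \<bar>r\<bar>"
proof -
  have "x\<^sup>2 + y\<^sup>2 \<le> r\<^sup>2 \<longleftrightarrow> sqrt (x\<^sup>2 + y\<^sup>2) \<le> \<bar>r\<bar>" for x y :: real
    by (metis real_sqrt_abs real_sqrt_le_iff)
  then show ?thesis
    by (auto simp: norm_prod_def)
qed

lemma nn_integral_disc:
  fixes r :: real
  shows "(\<integral>\<^sup>+y. \<integral>\<^sup>+x. indicator {(x, y). x\<^sup>2 + y\<^sup>2 \<le> r\<^sup>2} (x, y) \<partial>lborel \<partial>lborel)
    = ennreal (pi * r\<^sup>2)"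
  unfolding disc_eq_cball
proof -
  have "(\<integral>\<^sup>+y. \<integral>\<^sup>+x. indicator (cball (0 :: real \<times> real) \<bar>r\<bar>) (x, y) \<partial>lborel \<partial>lborel)
      = (\<integral>\<^sup>+p. indicator (cball (0 :: real \<times> real) \<bar>r\<bar>) p \<partial>(lborel \<Otimes>\<^sub>M lborel))"
    by (rule lborel_pair.nn_integral_snd)
      (auto simp: lborel_prod intro!: borel_measurable_indicator)
  also have "\<dots> = emeasure lborel (cball (0 :: real \<times> real) \<bar>r\<bar>)"
    by (simp add: lborel_prod)
  also have "\<dots> = ennreal (pi * r\<^sup>2)"
    by (simp add: emeasure_cball eval_unit_ball_vol numeral_2_eq_2[symmetric])
  finally show "(\<integral>\<^sup>+y. \<integral>\<^sup>+x. indicator (cball (0 :: real \<times> real) \<bar>r\<bar>) (x, y) \<partial>lborel \<partial>lborel)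
    = ennreal (pi * r\<^sup>2)" .
qed

text \<open>Tonelli with a weight \<phi> depending on the height alone: \<phi> = 1 yields the volume
  and \<phi> z = z the first moment. Nonnegative integrals avoid a separate integrability
  argument.\<close>

lemma nn_integral_filled_part:
  fixes \<phi> :: "real \<Rightarrow> real"
  assumes g: "\<And>z. z \<in> {0..H} \<Longrightarrow> 0 \<le> g z" "continuous_on {0..H} g" and h: "h \<le> H"
    and \<phi>: "\<And>z. z \<in> {0..h} \<Longrightarrow> 0 \<le> \<phi> z" "continuous_on UNIV \<phi>"
  shows "(\<integral>\<^sup>+(x, y, z). ennreal (\<phi> z) * indicator (filled_part g H h) (x, y, z) \<partial>lborel)
    = ennreal (pi * integral {0..h} (\<lambda>z. \<phi> z * (g z)\<^sup>2))"
proof -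
  let ?F = "filled_part g H h"
  let ?f = "\<lambda>(x, y, z). ennreal (\<phi> z) * indicator ?F (x, y, z)"
  have [measurable]: "?F \<in> sets borel" "\<phi> \<in> borel_measurable borel"
    using closed_filled_part[OF g h] \<phi>(2) by (auto intro: borel_measurable_continuous_onI)
  have f: "?f \<in> borel_measurable borel"
    unfolding borel_prod[symmetric] case_prod_beta
    by measurable
  have f_x: "?f \<in> borel_measurable (lborel \<Otimes>\<^sub>M lborel)"
    using f by (simp add: lborel_prod)
  \<comment> \<open>The variable \<open>x\<close> is integrated first; the inner integral must be
    measurable in the remaining pair \<open>q\<close> before Tonelli can be applied a second
    time.\<close>
  have "(\<lambda>(q, x). ?f (x, q)) \<in> borel_measurable (lborel \<Otimes>\<^sub>M lborel)"
    by (rule measurable_pair_swap[OF f_x])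
  from lborel.borel_measurable_nn_integral[OF this]
  have f_yz: "(\<lambda>q. \<integral>\<^sup>+x. ?f (x, q) \<partial>lborel) \<in> borel_measurable (lborel \<Otimes>\<^sub>M lborel)"
    by (simp only: lborel_prod)
  have "(\<integral>\<^sup>+p. ?f p \<partial>lborel) = (\<integral>\<^sup>+q. \<integral>\<^sup>+x. ?f (x, q) \<partial>lborel \<partial>lborel)"
    using lborel_pair.nn_integral_snd[OF f_x] by (simp only: lborel_prod)
  also have "\<dots> = (\<integral>\<^sup>+z. \<integral>\<^sup>+y. \<integral>\<^sup>+x. ?f (x, y, z) \<partial>lborel \<partial>lborel \<partial>lborel)"
    using lborel_pair.nn_integral_snd[OF f_yz] by (simp only: lborel_prod)
  also have "\<dots> = (\<integral>\<^sup>+z. ennreal (pi * (\<phi> z * (g z)\<^sup>2)) * indicator {0..h} z \<partial>lborel)"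
  proof (rule nn_integral_cong)
    fix z :: real
    let ?D = "{(x, y). x\<^sup>2 + y\<^sup>2 \<le> (g z)\<^sup>2}"
    have D[measurable]: "?D \<in> sets (lborel \<Otimes>\<^sub>M lborel)"
      unfolding disc_eq_cball lborel_prod by simp
    \<comment> \<open>At a fixed height the indicator splits into a factor in \<open>z\<close> and
      the indicator of a disc in \<open>(x, y)\<close>.\<close>
    have "(\<integral>\<^sup>+y. \<integral>\<^sup>+x. ?f (x, y, z) \<partial>lborel \<partial>lborel)
        = (\<integral>\<^sup>+y. \<integral>\<^sup>+x. (ennreal (\<phi> z) * indicator {0..h} z) * indicator ?D (x, y) \<partial>lborel \<partial>lborel)"
      using mem_filled_part_iff[OF g(1) h]
      by (intro nn_integral_cong) (auto simp: indicator_def)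
    also have "\<dots> = (ennreal (\<phi> z) * indicator {0..h} z) *
        (\<integral>\<^sup>+y. \<integral>\<^sup>+x. indicator ?D (x, y) \<partial>lborel \<partial>lborel)"
      by (subst nn_integral_cmult, measurable)+
    also have "\<dots> = ennreal (pi * (\<phi> z * (g z)\<^sup>2)) * indicator {0..h} z"
    proof (cases "z \<in> {0..h}")
      case True
      then show ?thesis
        using \<phi>(1)
        by (simp add: nn_integral_disc ennreal_mult[symmetric] mult.left_commute)
    qed simp
    finally show "(\<integral>\<^sup>+y. \<integral>\<^sup>+x. ?f (x, y, z) \<partial>lborel \<partial>lborel)
        = ennreal (pi * (\<phi> z * (g z)\<^sup>2)) * indicator {0..h} z" .
  qed
  also have "\<dots> = ennreal (pi * integral {0..h} (\<lambda>z. \<phi> z * (g z)\<^sup>2))"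
  proof (rule nn_integral_has_integral_lebesgue')
    have "continuous_on {0..h} (\<lambda>z. \<phi> z * (g z)\<^sup>2)"
      using g(2) \<phi>(2) h by (auto intro!: continuous_intros intro: continuous_on_subset)
    then show "((\<lambda>z. pi * (\<phi> z * (g z)\<^sup>2)) has_integral
        pi * integral {0..h} (\<lambda>z. \<phi> z * (g z)\<^sup>2)) {0..h}"
      by (intro has_integral_mult_right integrable_integral integrable_continuous_real)
  qed (use \<phi> in auto)
  finally show ?thesis .
qed

lemma measure_filled_part:
  assumes "\<And>z. z \<in> {0..H} \<Longrightarrow> 0 \<le> g z" "continuous_on {0..H} g" "h \<le> H"
  shows "measure lborel (filled_part g H h) = pi * integral {0..h} (\<lambda>z. (g z)\<^sup>2)"
proof -
  have "filled_part g H h \<in> sets lborel"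
    using closed_filled_part[OF assms] by simp
  then have "emeasure lborel (filled_part g H h)
      = (\<integral>\<^sup>+(x, y, z). ennreal 1 * indicator (filled_part g H h) (x, y, z) \<partial>lborel)"
    by (simp add: case_prod_beta)
  also have "\<dots> = ennreal (pi * integral {0..h} (\<lambda>z. 1 * (g z)\<^sup>2))"
    by (rule nn_integral_filled_part) (use assms in auto)
  moreover have "0 \<le> integral {0..h} (\<lambda>z. (g z)\<^sup>2)"
    using assms(2,3)
    by (auto intro!: integral_nonneg integrable_continuous_real continuous_intros
        intro: continuous_on_subset)
  ultimately show ?thesis
    by (simp add: measure_def)
qed

text \<open>Heights are nonnegative on the filled part, so the Bochner integral is a nonnegative
  integral and slicing applies with the identity as weight.\<close>

lemma set_lebesgue_integral_filled_part:
  assumes "\<And>z. z \<in> {0..H} \<Longrightarrow> 0 \<le> g z" "continuous_on {0..H} g" "h \<le> H"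
  shows "set_lebesgue_integral lborel (filled_part g H h) (\<lambda>(x, y, z). z)
    = pi * integral {0..h} (\<lambda>z. z * (g z)\<^sup>2)"
proof -
  let ?F = "filled_part g H h"
  have [measurable]: "?F \<in> sets borel"
    using closed_filled_part[OF assms] by simp
  have "(\<lambda>p :: real \<times> real \<times> real. case p of (x, y, z) \<Rightarrow> z) \<in> borel_measurable borel"
    unfolding case_prod_beta by (intro borel_measurable_continuous_onI continuous_intros)
  then have "(\<lambda>p. indicator ?F p *\<^sub>R (case p of (x, y, z) \<Rightarrow> z)) \<in> borel_measurable lborel"
    by measurable
  moreover have nonneg: "0 \<le> indicator ?F p *\<^sub>R (case p of (x, y, z) \<Rightarrow> z)" for p
    by (auto simp: indicator_def filled_part_def split: prod.splits)
  ultimately have "set_lebesgue_integral lborel ?F (\<lambda>(x, y, z). z)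
      = enn2real (\<integral>\<^sup>+p. ennreal (indicator ?F p *\<^sub>R (case p of (x, y, z) \<Rightarrow> z)) \<partial>lborel)"
    unfolding set_lebesgue_integral_def by (intro integral_eq_nn_integral) auto
  also have "(\<integral>\<^sup>+p. ennreal (indicator ?F p *\<^sub>R (case p of (x, y, z) \<Rightarrow> z)) \<partial>lborel)
      = (\<integral>\<^sup>+(x, y, z). ennreal z * indicator ?F (x, y, z) \<partial>lborel)"
    by (intro nn_integral_cong) (auto simp: indicator_def)
  also have "\<dots> = ennreal (pi * integral {0..h} (\<lambda>z. z * (g z)\<^sup>2))"
    by (rule nn_integral_filled_part) (use assms in auto)
  also have "enn2real \<dots> = pi * integral {0..h} (\<lambda>z. z * (g z)\<^sup>2)"
  proof -
    have "continuous_on {0..h} (\<lambda>z. z * (g z)\<^sup>2)"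
      using assms by (auto intro!: continuous_intros intro: continuous_on_subset)
    then show ?thesis
      by (auto intro!: enn2real_ennreal mult_nonneg_nonneg integral_nonneg integrable_continuous_real)
  qed
  finally show ?thesis .
qed

section \<open>Minimum and fixed point of a quotient of moments\<close>

text \<open>Derivatives relative to one fixed set \<open>S\<close> keep the endpoints one-sided and
  still serve every subinterval.\<close>

lemma mvt_real_within:
  fixes f :: "real \<Rightarrow> real"
  assumes "a < b" and "{a..b} \<subseteq> S"
    and "\<And>x. x \<in> {a..b} \<Longrightarrow> (f has_real_derivative f' x) (at x within S)"
  obtains x where "a < x" "x < b" "f b - f a = f' x * (b - a)"
proof -
  have "(f has_derivative (*) (f' x)) (at x within {a..b})" if "a \<le> x" "x \<le> b" for x
    using has_field_derivative_subset[OF assms(3,2)] that by (simp add: has_field_derivative_def)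
  from mvt_simple[OF assms(1) this] that show thesis
    by auto
qed

text \<open>Free of geometry: all that enters is that mass added at level \<open>h\<close> has lever
  arm \<open>h\<close>, that mass is always being added, and that the quotient starts above
  \<open>0\<close> and ends below \<open>H\<close>.\<close>

lemma quotient_of_moments_minimum_eq_fixed_point:
  fixes m0 m1 w :: "real \<Rightarrow> real"
  assumes "0 < H"
    and m0: "\<And>h. h \<in> {0..H} \<Longrightarrow> (m0 has_real_derivative w h) (at h within {0..H})"
    and m1: "\<And>h. h \<in> {0..H} \<Longrightarrow> (m1 has_real_derivative h * w h) (at h within {0..H})"
    and w: "\<And>h. h \<in> {0..H} \<Longrightarrow> 0 < w h"
    and pos: "0 < m0 0" and lower: "0 < m1 0" and upper: "m1 H < H * m0 H"
  defines "T \<equiv> \<lambda>h. m1 h / m0 h"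
  shows "\<exists>h0. {h. is_arg_min T (\<lambda>h. h \<in> {0..H}) h} = {h0} \<and> {h \<in> {0..H}. T h = h} = {h0}"
proof -
  have m0_less: "m0 a < m0 b" if ab: "0 \<le> a" "a < b" "b \<le> H" for a b
  proof -
    obtain x where x: "a < x" "x < b" "m0 b - m0 a = w x * (b - a)"
      by (rule mvt_real_within[of a b "{0..H}" m0 w]) (use ab m0 in auto)
    then have "0 < w x * (b - a)"
      using w[of x] ab by simp
    then show ?thesis
      using x by simp
  qed
  have m0_pos: "0 < m0 h" if "h \<in> {0..H}" for h
    using m0_less[of 0 h] that pos by (cases "h = 0") auto
  define D where "D = (\<lambda>h. h * m0 h - m1 h)"
  \<comment> \<open>By the product rule the two terms \<open>h * w h\<close> cancel.\<close>
  have D: "(D has_real_derivative m0 h) (at h within {0..H})" if "h \<in> {0..H}" for h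
    unfolding D_def using that by (auto intro!: derivative_eq_intros m0 m1)
  have D_mvt: "\<exists>x. a < x \<and> x < b \<and> D b - D a = m0 x * (b - a)" if ab: "0 \<le> a" "a < b" "b \<le> H"
    for a b
    by (rule mvt_real_within[of a b "{0..H}" D m0]) (use ab D in auto)
  have "continuous_on {0..H} D"
    by (rule DERIV_continuous_on[OF D])
  then obtain h0 where h0: "h0 \<in> {0..H}" "D h0 = 0"
    using IVT'[of D 0 0 H] lower upper \<open>0 < H\<close> by (auto simp: D_def)
  have fixed: "T h0 = h0"
    using h0 m0_pos[of h0] by (simp add: T_def D_def field_simps)
  have greater: "h0 < T h \<and> T h \<noteq> h" if h: "h \<in> {0..H}" "h \<noteq> h0" for h
  proof -
    \<comment> \<open>As \<open>x\<close> lies strictly between \<open>h0\<close> and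
      \<open>h\<close> and \<open>m0\<close> increases, \<open>m0 h - m0 x\<close> has the sign of
      \<open>h - h0\<close>; both orderings thus give the same product form.\<close>
    obtain x where x: "x \<in> {0..H}" "D h = (h - h0) * m0 x" "0 < (h - h0) * (m0 h - m0 x)"
    proof (cases "h0 < h")
      case True
      with D_mvt[of h0 h] h h0 obtain x where "h0 < x" "x < h" "D h = m0 x * (h - h0)"
        by auto
      with m0_less[of x h] h h0 show thesis
        by (intro that[of x]) (auto simp: mult.commute)
    next
      case False
      with D_mvt[of h h0] h h0 obtain x where "h < x" "x < h0" "- D h = m0 x * (h0 - h)"
        by auto
      with m0_less[of h x] h h0 show thesis
        by (intro that[of x] mult_neg_neg) (auto simp: algebra_simps)
    qed
    have "m1 h - h0 * m0 h = (h - h0) * m0 h - D h"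
      by (simp add: D_def algebra_simps)
    also have "\<dots> > 0"
      using x by (simp add: algebra_simps)
    finally have "h0 < T h"
      using m0_pos[OF h(1)] by (simp add: T_def field_simps)
    moreover have "D h \<noteq> 0"
      using x m0_pos[of x] h by auto
    then have "T h \<noteq> h"
      using m0_pos[OF h(1)] by (auto simp: T_def D_def field_simps)
    ultimately show ?thesis ..
  qed
  \<comment> \<open>The value at \<open>h0\<close> is \<open>h0\<close> itself, and every other
    value is strictly larger, which also gives uniqueness.\<close>
  have "{h. is_arg_min T (\<lambda>h. h \<in> {0..H}) h} = {h0}"
    using greater h0 fixed by (fastforce simp: is_arg_min_def)
  moreover have "{h \<in> {0..H}. T h = h} = {h0}"
    using greater h0 fixed by auto
  ultimately show ?thesis
    by blast
qed

section \<open>The moments of the filled solid and the final result\<close>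

theorem theorem3:
  fixes H \<alpha> \<beta> :: real and g g' :: "real \<Rightarrow> real"
  assumes "H > 0" and "\<alpha> > 0" and "\<beta> > 0"
    and "\<And>z. z \<in> {0..H} \<Longrightarrow> g z > 0"
    and "\<And>z. z \<in> {0..H} \<Longrightarrow> (g has_real_derivative g' z) (at z within {0..H})"
    and "continuous_on {0..H} g'"
  defines "T \<equiv> T_sr \<alpha> \<beta> g g' H"
    and "m0 \<equiv> moment0 \<alpha> \<beta> g g' H"
    and "S0 \<equiv> surface_moment0 g g' H"
    and "S1 \<equiv> surface_moment1 g g' H"
  shows "(\<forall>h\<in>{0..H}. T h =
            (\<alpha> * S1 + pi * \<beta> * integral {0..h} (\<lambda>z. z * (g z)\<^sup>2)) /
            (\<alpha> * S0 + pi * \<beta> * integral {0..h} (\<lambda>z. (g z)\<^sup>2)))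
       \<and> (\<exists>h0. {h. is_arg_min T (\<lambda>h. h \<in> {0..H}) h} = {h0} \<and> {h \<in> {0..H}. T h = h} = {h0})
       \<and> (\<forall>h\<in>{0..H}. m0 h = \<alpha> * S0 + pi * \<beta> * integral {0..h} (\<lambda>z. (g z)\<^sup>2))
       \<and> (\<forall>h\<in>{0..H}. \<exists>m0'. (m0 has_real_derivative m0') (at h within {0..H})
            \<and> (T has_real_derivative - (m0' / m0 h) * (T h - h)) (at h within {0..H}))"
proof -
  have g_cont: "continuous_on {0..H} g"
    by (rule DERIV_continuous_on[OF assms(5)])
  have g_nonneg: "0 \<le> g z" if "z \<in> {0..H}" for z
    using assms(4)[OF that] by simp
  define m1 where "m1 = moment1 \<alpha> \<beta> g g' H"
  \<comment> \<open>The mass per unit height of the disc at level \<open>h\<close>, which is the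
    derivative of \<open>m0\<close>.\<close>
  define w where "w = (\<lambda>h. pi * \<beta> * (g h)\<^sup>2)"
  have m0_eq: "m0 h = \<alpha> * S0 + pi * \<beta> * integral {0..h} (\<lambda>z. (g z)\<^sup>2)" if "h \<in> {0..H}" for h
    using that measure_filled_part[of H g h] g_nonneg g_cont
    by (simp add: m0_def moment0_def S0_def mult_ac)
  have m1_eq: "m1 h = \<alpha> * S1 + pi * \<beta> * integral {0..h} (\<lambda>z. z * (g z)\<^sup>2)" if "h \<in> {0..H}" for h
    using that set_lebesgue_integral_filled_part[of H g h] g_nonneg g_cont
    by (simp add: m1_def moment1_def S1_def mult_ac)
  have T_eq: "T = (\<lambda>h. m1 h / m0 h)"
    by (simp add: T_def T_sr_def m0_def m1_def fun_eq_iff)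
  have m0_deriv: "(m0 has_real_derivative w h) (at h within {0..H})" if "h \<in> {0..H}" for h
      unfolding has_field_derivative_def
  \<comment> \<open>The integral formula is known only for heights in \<open>{0..H}\<close>, which
    suffices for a derivative relative to that interval.\<close>
  proof (rule has_derivative_transform[OF that m0_eq])
    have "((\<lambda>h. integral {0..h} (\<lambda>z. (g z)\<^sup>2)) has_real_derivative (g h)\<^sup>2) (at h within {0..H})"
      by (intro integral_has_real_derivative continuous_intros g_cont that)
    then show "((\<lambda>h. \<alpha> * S0 + pi * \<beta> * integral {0..h} (\<lambda>z. (g z)\<^sup>2)) has_derivative (*) (w h))
        (at h within {0..H})"
      unfolding has_field_derivative_def[symmetric]
      by (auto intro!: derivative_eq_intros simp: w_def)
  qed
  have m1_deriv: "(m1 has_real_derivative h * w h) (at h within {0..H})" if "h \<in> {0..H}" for h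
      unfolding has_field_derivative_def
  proof (rule has_derivative_transform[OF that m1_eq])
    have "((\<lambda>h. integral {0..h} (\<lambda>z. z * (g z)\<^sup>2)) has_real_derivative h * (g h)\<^sup>2) (at h within {0..H})"
      by (intro integral_has_real_derivative continuous_intros g_cont that)
    then show "((\<lambda>h. \<alpha> * S1 + pi * \<beta> * integral {0..h} (\<lambda>z. z * (g z)\<^sup>2)) has_derivative (*) (h * w h))
        (at h within {0..H})"
      unfolding has_field_derivative_def[symmetric]
      by (auto intro!: derivative_eq_intros simp: w_def)
  qed
  \<comment> \<open>The area element of the surface without the factor
    \<open>2 * pi\<close>.\<close>
  define s where "s = (\<lambda>z. g z * sqrt (1 + (g' z)\<^sup>2))"
  have s_cont: "continuous_on {0..H} s"
    unfolding s_def by (intro continuous_intros g_cont assms(6))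
  have s_pos: "0 < s z" if "z \<in> {0..H}" for z
    using assms(4)[OF that] by (simp add: s_def add_pos_nonneg)
  have S0_eq: "S0 = 2 * pi * integral {0..H} s"
    by (simp add: S0_def surface_moment0_def s_def)
  have S1_eq: "S1 = 2 * pi * integral {0..H} (\<lambda>z. z * s z)"
    by (simp add: S1_def surface_moment1_def s_def mult.assoc)
  have "integral {0..H} (\<lambda>z. 0) < integral {0..H} s"
    by (rule integral_less_real) (use s_cont s_pos \<open>H > 0\<close> in auto)
  then have S0_pos: "0 < S0"
    by (simp add: S0_eq)
  \<comment> \<open>The integrand vanishes at \<open>z = 0\<close>, but strict inequality on the
    open interval is enough.\<close>
  have "integral {0..H} (\<lambda>z. 0) < integral {0..H} (\<lambda>z. z * s z)"
    by (rule integral_less_real) (use s_cont s_pos \<open>H > 0\<close> in \<open>auto intro!: continuous_intros\<close>)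
  then have S1_pos: "0 < S1"
    by (simp add: S1_eq)
  \<comment> \<open>Interior levels satisfy \<open>z < H\<close>, so the surface balances strictly
    below \<open>H\<close>. The same comparison for the filling then gives
    \<open>upper\<close>.\<close>
  have "integral {0..H} (\<lambda>z. z * s z) < integral {0..H} (\<lambda>z. H * s z)"
    by (rule integral_less_real) (use s_cont s_pos \<open>H > 0\<close> in \<open>auto intro!: continuous_intros\<close>)
  then have S1_less: "S1 < H * S0"
    by (simp add: S0_eq S1_eq)
  have "integral {0..H} (\<lambda>z. z * (g z)\<^sup>2) < integral {0..H} (\<lambda>z. H * (g z)\<^sup>2)"
  proof (rule integral_less_real)
    show "z * (g z)\<^sup>2 < H * (g z)\<^sup>2" if "z \<in> {0<..<H}" for z
      using assms(4)[of z] that by simp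
  qed (use g_cont \<open>H > 0\<close> in \<open>auto intro!: continuous_intros\<close>)
  then have "integral {0..H} (\<lambda>z. z * (g z)\<^sup>2) < H * integral {0..H} (\<lambda>z. (g z)\<^sup>2)"
    by simp
  then have g_moments: "pi * \<beta> * integral {0..H} (\<lambda>z. z * (g z)\<^sup>2)
      < pi * \<beta> * (H * integral {0..H} (\<lambda>z. (g z)\<^sup>2))"
    using \<open>\<beta> > 0\<close> by simp
  have "\<alpha> * S1 < \<alpha> * (H * S0)"
    using S1_less \<open>\<alpha> > 0\<close> by simp
  moreover have "m1 H = \<alpha> * S1 + pi * \<beta> * integral {0..H} (\<lambda>z. z * (g z)\<^sup>2)"
    using \<open>H > 0\<close> by (intro m1_eq) simp
  ultimately have "m1 H < \<alpha> * (H * S0) + pi * \<beta> * (H * integral {0..H} (\<lambda>z. (g z)\<^sup>2))"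
    using g_moments by linarith
  also have "\<dots> = H * m0 H"
    using \<open>H > 0\<close> by (simp add: m0_eq distrib_left mult_ac)
  finally have upper: "m1 H < H * m0 H" .
  have m0_pos: "0 < m0 h" if "h \<in> {0..H}" for h
  proof -
    have "0 \<le> integral {0..h} (\<lambda>z. (g z)\<^sup>2)"
      using g_cont that
      by (auto intro!: integral_nonneg integrable_continuous_real continuous_intros
          intro: continuous_on_subset)
    then show ?thesis
      using that S0_pos \<open>\<alpha> > 0\<close> \<open>\<beta> > 0\<close> by (simp add: m0_eq add_pos_nonneg)
  qed
  have "\<exists>h0. {h. is_arg_min T (\<lambda>h. h \<in> {0..H}) h} = {h0} \<and> {h \<in> {0..H}. T h = h} = {h0}"
    unfolding T_eq
  proof (rule quotient_of_moments_minimum_eq_fixed_point[OF \<open>H > 0\<close> m0_deriv m1_deriv])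
    show "0 < w h" if "h \<in> {0..H}" for h
      using assms(4)[OF that] \<open>\<beta> > 0\<close> by (simp add: w_def)
    \<comment> \<open>At height \<open>0\<close> the filling contributes nothing, and
      \<open>\<alpha> * S1\<close> remains.\<close>
    show "0 < m1 0"
      using S1_pos \<open>\<alpha> > 0\<close> \<open>H > 0\<close> by (simp add: m1_eq)
  qed (use m0_pos upper \<open>H > 0\<close> in auto)
  \<comment> \<open>The quotient rule gives
    \<open>(h * w h * m0 h - m1 h * w h) / (m0 h)\<^sup>2\<close>; factoring out
    \<open>w h / m0 h\<close> leaves \<open>h - T h\<close>.\<close>
  moreover have "(T has_real_derivative - (w h / m0 h) * (T h - h)) (at h within {0..H})"
    if "h \<in> {0..H}" for h
    unfolding T_eq using m0_pos[OF that]
    by (auto intro!: derivative_eq_intros m0_deriv m1_deriv that simp: field_simps)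
  moreover have "T h = (\<alpha> * S1 + pi * \<beta> * integral {0..h} (\<lambda>z. z * (g z)\<^sup>2)) /
      (\<alpha> * S0 + pi * \<beta> * integral {0..h} (\<lambda>z. (g z)\<^sup>2))" if "h \<in> {0..H}" for h
    using m0_eq[OF that] m1_eq[OF that] by (simp only: T_eq)
  ultimately show ?thesis
    using m0_eq m0_deriv by blast
qed

end
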